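(* Let $\omega\in\mathbb{R}$ and let $x_n=x_n(\omega)=\operatorname{tr}(T_n(\omega))$ and $t_n=t_n(\omega)=\operatorname{tr}(T_{n-2}(\omega)T_{n-1}(\omega))$ be associated with the silver mean Fibonacci tiling ($m=2$, $l=1$), so that they satisfy the silver mean recursion relation $$x_{n+1}=x_n t_{n+1}-x_{n-1},\qquad t_{n+1}=x_n x_{n-1}-t_n,\qquad n\geq 2.$$ Suppose that there exists some $N\in\mathbb{N}$ such that $$|x_N|>2,\qquad |x_{N+1}|\geq |x_N|\qquad\text{and}\qquad |x_{N+2}|\geq |x_{N+1}|.$$ Then $|x_{n+1}|\geq |x_n|$ for all $n>N$. Consequently, $|x_n|>2$ for all $n\geq N$, meaning that $\omega$ is in the super band gap $\mathcal{S}_N$.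
   Context: Generalised Fibonacci tilings with parameters $m,l\ge 1$ (positive integers) are words $\mathcal{F}_n$ in two letters $A,B$ generated by the substitution $A\to A^mB^l$, $B\to A$, starting from $\mathcal{F}_0=B$, $\mathcal{F}_1=A$. To each frequency $\omega$ are associated transfer matrices $T_n(\omega)\in\mathbb{R}^{2\times 2}$ with $\det T_n(\omega)=1$, where $T_0$ is the transfer matrix of the element $B$, $T_1$ that of the element $A$, and $T_{n+1}=T_{n-1}^{\,l}\,T_n^{\,m}$ for $n\geq 1$. The super band gap is $\mathcal{S}_N:=\{\omega\in\mathbb{R}: |x_n(\omega)|>2 \text{ for all } n\geq N\}$, where $x_n(\omega)=\operatorname{tr}(T_n(\omega))$. *)

theory Defs
  imports "HOL-Analysis.Analysis"
begin

datatype letter = A | B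

fun subst_letter :: "nat \<Rightarrow> nat \<Rightarrow> letter \<Rightarrow> letter list" where
  "subst_letter m l A = replicate m A @ replicate l B"
| "subst_letter m l B = [A]"

definition subst_word :: "nat \<Rightarrow> nat \<Rightarrow> letter list \<Rightarrow> letter list" where
  "subst_word m l w = concat (map (subst_letter m l) w)"

definition fib_tiling :: "nat \<Rightarrow> nat \<Rightarrow> nat \<Rightarrow> letter list" where
  "fib_tiling m l n = (subst_word m l ^^ n) [B]"

text \<open>
  On \<^typ>\<open>real^2^2\<close> the overloaded power would be taken entrywise, so powers with respect to
  the matrix product need their own definition.
\<close>
primrec matpow :: "real^2^2 \<Rightarrow> nat \<Rightarrow> real^2^2" where
  "matpow M 0 = mat 1"
| "matpow M (Suc k) = M ** matpow M k"

text \<open>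
  \<open>TA\<close> and \<open>TB\<close> give the transfer matrices of the elements \<open>A\<close> and \<open>B\<close> at each frequency.
  \<open>transfer m l TA TB n \<omega>\<close> is $T_n(\omega)$, the transfer matrix across \<^term>\<open>fib_tiling m l n\<close>
  (see \<open>transfer_eq_word\<close> below).
\<close>
fun transfer :: "nat \<Rightarrow> nat \<Rightarrow> (real \<Rightarrow> real^2^2) \<Rightarrow> (real \<Rightarrow> real^2^2) \<Rightarrow> nat \<Rightarrow> real \<Rightarrow> real^2^2" where
  "transfer m l TA TB 0 \<omega> = TB \<omega>"
| "transfer m l TA TB (Suc 0) \<omega> = TA \<omega>"
| "transfer m l TA TB (Suc (Suc n)) \<omega> =
     matpow (transfer m l TA TB n \<omega>) l ** matpow (transfer m l TA TB (Suc n) \<omega>) m"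

definition xtrace :: "nat \<Rightarrow> nat \<Rightarrow> (real \<Rightarrow> real^2^2) \<Rightarrow> (real \<Rightarrow> real^2^2) \<Rightarrow> nat \<Rightarrow> real \<Rightarrow> real" where
  "xtrace m l TA TB n \<omega> = trace (transfer m l TA TB n \<omega>)"

text \<open>Only meaningful for \<open>n \<ge> 2\<close>, because of the truncated subtraction.\<close>
definition ttrace :: "nat \<Rightarrow> nat \<Rightarrow> (real \<Rightarrow> real^2^2) \<Rightarrow> (real \<Rightarrow> real^2^2) \<Rightarrow> nat \<Rightarrow> real \<Rightarrow> real" where
  "ttrace m l TA TB n \<omega> =
     trace (transfer m l TA TB (n - 2) \<omega> ** transfer m l TA TB (n - 1) \<omega>)"

definition super_band_gap ::
    "nat \<Rightarrow> nat \<Rightarrow> (real \<Rightarrow> real^2^2) \<Rightarrow> (real \<Rightarrow> real^2^2) \<Rightarrow> nat \<Rightarrow> real set" where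
  "super_band_gap m l TA TB N = {\<omega>. \<forall>n\<ge>N. \<bar>xtrace m l TA TB n \<omega>\<bar> > 2}"

text \<open>
  The transfer matrix across a word: the leftmost element acts first, hence is the rightmost factor.
\<close>
primrec word_transfer :: "real^2^2 \<Rightarrow> real^2^2 \<Rightarrow> letter list \<Rightarrow> real^2^2" where
  "word_transfer MA MB [] = mat 1"
| "word_transfer MA MB (c # w) =
     word_transfer MA MB w ** (case c of A \<Rightarrow> MA | B \<Rightarrow> MB)"

lemma word_transfer_append:
  "word_transfer MA MB (v @ w) = word_transfer MA MB w ** word_transfer MA MB v"
  by (induction v) (simp_all add: matrix_mul_assoc)

lemma matpow_commute: "matpow M k ** M = M ** matpow M k"
  by (induction k) (simp_all add: matrix_mul_assoc [symmetric])

lemma word_transfer_concat_replicate: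
  "word_transfer MA MB (concat (replicate k w)) = matpow (word_transfer MA MB w) k"
  by (induction k) (simp_all add: word_transfer_append matpow_commute)

lemma subst_word_append: "subst_word m l (v @ w) = subst_word m l v @ subst_word m l w"
  by (simp add: subst_word_def)

lemma subst_word_pow_append:
  "(subst_word m l ^^ n) (v @ w) = (subst_word m l ^^ n) v @ (subst_word m l ^^ n) w"
  by (induction n) (simp_all add: subst_word_append)

lemma subst_word_pow_replicate:
  "(subst_word m l ^^ n) (replicate k c) = concat (replicate k ((subst_word m l ^^ n) [c]))"
proof (induction k)
  case 0
  have "(subst_word m l ^^ n) [] = []"
    by (induction n) (simp_all add: subst_word_def)
  then show ?case by simp
next
  case (Suc k)
  then show ?case
    using subst_word_pow_append [of n m l "[c]" "replicate k c"] by simp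
qed

lemma fib_tiling_0: "fib_tiling m l 0 = [B]"
  by (simp add: fib_tiling_def)

lemma fib_tiling_1: "fib_tiling m l (Suc 0) = [A]"
  by (simp add: fib_tiling_def subst_word_def)

lemma fib_tiling_Suc: "fib_tiling m l (Suc n) = (subst_word m l ^^ n) [A]"
  unfolding fib_tiling_def funpow_Suc_right by (simp add: subst_word_def)

lemma fib_tiling_Suc_Suc:
  "fib_tiling m l (Suc (Suc n)) =
     concat (replicate m (fib_tiling m l (Suc n))) @ concat (replicate l (fib_tiling m l n))"
proof -
  have "fib_tiling m l (Suc (Suc n)) = (subst_word m l ^^ n) (replicate m A @ replicate l B)"
    unfolding fib_tiling_Suc [of m l "Suc n"] funpow_Suc_right by (simp add: subst_word_def)
  then show ?thesis
    unfolding fib_tiling_Suc [of m l n]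
    by (simp add: fib_tiling_def subst_word_pow_append subst_word_pow_replicate)
qed

lemma transfer_eq_word:
  "transfer m l TA TB n \<omega> = word_transfer (TA \<omega>) (TB \<omega>) (fib_tiling m l n)"
  by (induction m l TA TB n \<omega> rule: transfer.induct)
    (simp_all add: fib_tiling_0 fib_tiling_1 fib_tiling_Suc_Suc
      word_transfer_append word_transfer_concat_replicate)

end

theory Submission imports Defs begin

text \<open>
  By Cayley-Hamilton, \<open>M\<^sup>2 = tr M \<cdot> M - I\<close> for a \<open>2 \<times> 2\<close> matrix of determinant one. Taking the
  trace of \<open>T\<^sub>n\<^sub>+\<^sub>1 = T\<^sub>n\<^sub>-\<^sub>1 T\<^sub>n\<^sup>2\<close> and of \<open>T\<^sub>n\<^sub>-\<^sub>1 T\<^sub>n = T\<^sub>n\<^sub>-\<^sub>1 T\<^sub>n\<^sub>-\<^sub>2 T\<^sub>n\<^sub>-\<^sub>1\<^sup>2\<close> then gives the recursion for the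
  traces.

  For the growth, let \<open>a\<close>, \<open>b\<close>, \<open>c\<close>, \<open>d\<close> be four consecutive traces with \<open>2 < \<bar>a\<bar> \<le> \<bar>b\<bar> \<le> \<bar>c\<bar>\<close>.
  The mixed trace \<open>s\<close> that connects the first three satisfies \<open>b s = c + a\<close>, so that
  \<open>\<bar>s\<bar> \<le> \<bar>c\<bar> / \<bar>b\<bar> + 1\<close> is small compared with \<open>\<bar>b c\<bar>\<close>. The next trace
  \<open>d = c (b c - s) - b\<close> is therefore dominated by \<open>b c\<^sup>2\<close>, which yields \<open>\<bar>d\<bar> \<ge> \<bar>c\<bar>\<close>
  (\<open>trace_growth_step\<close>). The triple \<open>b\<close>, \<open>c\<close>, \<open>d\<close> satisfies the same hypotheses, and the argument
  can be iterated.
\<close>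

text \<open>This is Cayley-Hamilton for \<open>M\<close>, multiplied by \<open>X\<close> from the left, under the trace.\<close>

lemma trace_mult_square:
  fixes X M :: "real^2^2"
  shows "trace (X ** (M ** M)) = trace M * trace (X ** M) - det M * trace X"
  by (simp add: trace_def det_2 matrix_matrix_mult_def sum_2) (simp add: algebra_simps)

lemma transfer_silver_step:
  "transfer 2 1 TA TB (n + 2) \<omega> = transfer 2 1 TA TB n \<omega> **
     (transfer 2 1 TA TB (n + 1) \<omega> ** transfer 2 1 TA TB (n + 1) \<omega>)"
proof -
  have "matpow M 2 = M ** M" "matpow M 1 = M" for M
    by (simp_all add: numeral_2_eq_2)
  then show ?thesis by simp
qed

lemma det_transfer_silver:
  assumes "det (TA \<omega>) = 1" "det (TB \<omega>) = 1"
  shows "det (transfer 2 1 TA TB n \<omega>) = 1"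
proof (induction n rule: less_induct)
  case (less n)
  consider "n = 0" | "n = 1" | k where "n = k + 2"
    by (metis One_nat_def add_2_eq_Suc' not0_implies_Suc)
  then show ?case
  proof cases
    case 3
    then show ?thesis using less [of k] less [of "k + 1"] by (simp only: transfer_silver_step det_mul)
  qed (use assms in simp_all)
qed

lemma xtrace_silver_recursion:
  assumes "det (TA \<omega>) = 1" "det (TB \<omega>) = 1"
  shows "xtrace 2 1 TA TB (n + 2) \<omega> =
           xtrace 2 1 TA TB (n + 1) \<omega> * ttrace 2 1 TA TB (n + 2) \<omega> - xtrace 2 1 TA TB n \<omega>"
  unfolding xtrace_def ttrace_def transfer_silver_step
  using det_transfer_silver [of TA \<omega> TB "n + 1", OF assms] by (simp add: trace_mult_square)

text \<open>
  With \<open>Z = T\<^sub>n\<close> and \<open>Y = T\<^sub>n\<^sub>+\<^sub>1\<close> the left-hand side is \<open>tr (Y Z Y\<^sup>2)\<close>. Cayley-Hamilton lowers it to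
  \<open>tr Y \<cdot> tr (Y Z Y) - tr (Y Z)\<close>, and by cyclicity \<open>tr (Y Z Y) = tr (Z Y\<^sup>2)\<close> is the trace of \<open>T\<^sub>n\<^sub>+\<^sub>2\<close>.
\<close>

lemma ttrace_silver_recursion:
  assumes "det (TA \<omega>) = 1" "det (TB \<omega>) = 1"
  shows "ttrace 2 1 TA TB (n + 3) \<omega> =
           xtrace 2 1 TA TB (n + 2) \<omega> * xtrace 2 1 TA TB (n + 1) \<omega> - ttrace 2 1 TA TB (n + 2) \<omega>"
proof -
  define Y Z where "Y = transfer 2 1 TA TB (n + 1) \<omega>" and "Z = transfer 2 1 TA TB n \<omega>"
  have T: "transfer 2 1 TA TB (n + 2) \<omega> = Z ** (Y ** Y)"
    unfolding Y_def Z_def by (rule transfer_silver_step)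
  have "trace ((Y ** Z) ** (Y ** Y)) = trace Y * trace ((Y ** Z) ** Y) - trace (Y ** Z)"
    using det_transfer_silver [of TA \<omega> TB "n + 1", OF assms] by (simp add: trace_mult_square Y_def)
  moreover have "trace ((Y ** Z) ** Y) = trace (Z ** (Y ** Y))"
    using trace_mul_sym [of Y "Z ** Y"] by (simp add: matrix_mul_assoc)
  ultimately have "trace (Y ** (Z ** (Y ** Y))) = trace (Z ** (Y ** Y)) * trace Y - trace (Z ** Y)"
    by (simp add: matrix_mul_assoc trace_mul_sym [of Z Y])
  moreover have "ttrace 2 1 TA TB (n + 3) \<omega> = trace (Y ** (Z ** (Y ** Y)))"
    unfolding T [symmetric] by (simp add: ttrace_def Y_def)
  moreover have "xtrace 2 1 TA TB (n + 2) \<omega> = trace (Z ** (Y ** Y))"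
    unfolding T [symmetric] by (simp only: xtrace_def)
  moreover have "xtrace 2 1 TA TB (n + 1) \<omega> = trace Y"
    by (simp add: xtrace_def Y_def)
  moreover have "ttrace 2 1 TA TB (n + 2) \<omega> = trace (Z ** Y)"
    by (simp add: ttrace_def Y_def Z_def)
  ultimately show ?thesis by simp
qed

text \<open>
  Since \<open>\<bar>b\<bar> > 2\<close>, the product \<open>c b\<close> is at least \<open>2 \<bar>c\<bar>\<close> in absolute value, whereas
  \<open>\<bar>s\<bar> \<le> \<bar>c\<bar> / \<bar>b\<bar> + 1 \<le> \<bar>c\<bar> / 2 + 1\<close>. Hence \<open>\<bar>c b - s\<bar> \<ge> 3/2 \<cdot> \<bar>c\<bar> - 1 > 2\<close>, because
  \<open>\<bar>c\<bar> > 2\<close>, and \<open>\<bar>d\<bar> \<ge> 2 \<bar>c\<bar> - \<bar>b\<bar> \<ge> \<bar>c\<bar>\<close>.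
\<close>

lemma trace_growth_step:
  fixes a b c d s :: real
  assumes "2 < \<bar>a\<bar>" "\<bar>a\<bar> \<le> \<bar>b\<bar>" "\<bar>b\<bar> \<le> \<bar>c\<bar>"
    and c: "c = b * s - a" and d: "d = c * (c * b - s) - b"
  shows "\<bar>c\<bar> \<le> \<bar>d\<bar>"
proof -
  have b: "\<bar>b\<bar> > 2" and c2: "\<bar>c\<bar> > 2" using assms(1-3) by linarith+
  have "\<bar>b\<bar> * \<bar>s\<bar> = \<bar>c + a\<bar>" using c by (simp flip: abs_mult)
  also have "\<dots> \<le> \<bar>c\<bar> + \<bar>b\<bar>" using assms(2) by linarith
  finally have "\<bar>s\<bar> \<le> (\<bar>c\<bar> + \<bar>b\<bar>) / \<bar>b\<bar>" using b by (simp add: field_simps)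
  also have "\<dots> = \<bar>c\<bar> / \<bar>b\<bar> + 1" using b by (simp add: add_divide_distrib)
  also have "\<dots> \<le> \<bar>c\<bar> / 2 + 1" using b by (intro add_right_mono divide_left_mono) auto
  finally have s: "\<bar>s\<bar> \<le> \<bar>c\<bar> / 2 + 1" .
  have "2 * \<bar>c\<bar> \<le> \<bar>c * b\<bar>" using b mult_right_mono [of 2 "\<bar>b\<bar>" "\<bar>c\<bar>"] by (simp add: abs_mult mult.commute)
  then have "\<bar>c * b - s\<bar> \<ge> 2" using s c2 by linarith
  then have "2 * \<bar>c\<bar> \<le> \<bar>c * (c * b - s)\<bar>" using mult_left_mono [of 2 "\<bar>c * b - s\<bar>" "\<bar>c\<bar>"] by (simp add: abs_mult)
  then show ?thesis unfolding d using assms(3) by linarith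
qed

lemma silver_traces_increasing:
  fixes x t :: "nat \<Rightarrow> real"
  assumes x_rec: "\<And>n. x (n + 2) = x (n + 1) * t (n + 2) - x n"
    and t_rec: "\<And>n. t (n + 3) = x (n + 2) * x (n + 1) - t (n + 2)"
    and "2 < \<bar>x N\<bar>" "\<bar>x N\<bar> \<le> \<bar>x (N + 1)\<bar>" "\<bar>x (N + 1)\<bar> \<le> \<bar>x (N + 2)\<bar>"
    and "N \<le> n"
  shows "2 < \<bar>x n\<bar> \<and> \<bar>x n\<bar> \<le> \<bar>x (n + 1)\<bar> \<and> \<bar>x (n + 1)\<bar> \<le> \<bar>x (n + 2)\<bar>"
  using \<open>N \<le> n\<close>
proof (induction n rule: dec_induct)
  case base
  then show ?case using assms(3-5) by simp
next
  case (step n)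
  have "x (n + 3) = x (n + 2) * (x (n + 2) * x (n + 1) - t (n + 2)) - x (n + 1)"
    using x_rec [of "n + 1"] t_rec [of n] by (simp add: numeral_3_eq_3)
  then have "\<bar>x (n + 2)\<bar> \<le> \<bar>x (n + 3)\<bar>"
    using step.IH x_rec by (blast intro: trace_growth_step)
  then show ?case using step.IH by (simp add: numeral_3_eq_3)
qed

theorem theorem3p2:
  fixes TA TB :: "real \<Rightarrow> real^2^2" and \<omega> :: real
  assumes "\<And>\<omega>'. det (TA \<omega>') = 1"
    and "\<And>\<omega>'. det (TB \<omega>') = 1"
  shows "(\<forall>n\<ge>2.
            xtrace 2 1 TA TB (n + 1) \<omega> =
              xtrace 2 1 TA TB n \<omega> * ttrace 2 1 TA TB (n + 1) \<omega> - xtrace 2 1 TA TB (n - 1) \<omega> \<and>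
            ttrace 2 1 TA TB (n + 1) \<omega> =
              xtrace 2 1 TA TB n \<omega> * xtrace 2 1 TA TB (n - 1) \<omega> - ttrace 2 1 TA TB n \<omega>) \<and>
         (\<forall>N.
            \<bar>xtrace 2 1 TA TB N \<omega>\<bar> > 2 \<and>
            \<bar>xtrace 2 1 TA TB (N + 1) \<omega>\<bar> \<ge> \<bar>xtrace 2 1 TA TB N \<omega>\<bar> \<and>
            \<bar>xtrace 2 1 TA TB (N + 2) \<omega>\<bar> \<ge> \<bar>xtrace 2 1 TA TB (N + 1) \<omega>\<bar> \<longrightarrow>
              (\<forall>n>N. \<bar>xtrace 2 1 TA TB (n + 1) \<omega>\<bar> \<ge> \<bar>xtrace 2 1 TA TB n \<omega>\<bar>) \<and>
              (\<forall>n\<ge>N. \<bar>xtrace 2 1 TA TB n \<omega>\<bar> > 2) \<and>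
              \<omega> \<in> super_band_gap 2 1 TA TB N)"
proof -
  let ?x = "\<lambda>n. xtrace 2 1 TA TB n \<omega>" and ?t = "\<lambda>n. ttrace 2 1 TA TB n \<omega>"
  have x_rec: "?x (n + 2) = ?x (n + 1) * ?t (n + 2) - ?x n" for n
    using assms by (rule xtrace_silver_recursion)
  have t_rec: "?t (n + 3) = ?x (n + 2) * ?x (n + 1) - ?t (n + 2)" for n
    using assms by (rule ttrace_silver_recursion)
  have recursion: "?x (n + 1) = ?x n * ?t (n + 1) - ?x (n - 1) \<and>
      ?t (n + 1) = ?x n * ?x (n - 1) - ?t n" if n: "n \<ge> 2" for n
  proof -
    obtain k where "n = k + 2" using le_Suc_ex [OF n] by (auto simp: add.commute)
    then show ?thesis
      using x_rec [of "k + 1"] t_rec [of k] by (simp add: numeral_3_eq_3)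
  qed
  have growth: "2 < \<bar>?x n\<bar> \<and> \<bar>?x n\<bar> \<le> \<bar>?x (n + 1)\<bar>"
    if "\<bar>?x N\<bar> > 2 \<and> \<bar>?x (N + 1)\<bar> \<ge> \<bar>?x N\<bar> \<and> \<bar>?x (N + 2)\<bar> \<ge> \<bar>?x (N + 1)\<bar>" "N \<le> n" for N n
    using silver_traces_increasing [of ?x ?t N n, OF x_rec t_rec] that by blast
  show ?thesis
    unfolding super_band_gap_def mem_Collect_eq
  proof (intro conjI allI impI)
    fix N n
    assume hyp: "\<bar>?x N\<bar> > 2 \<and> \<bar>?x (N + 1)\<bar> \<ge> \<bar>?x N\<bar> \<and> \<bar>?x (N + 2)\<bar> \<ge> \<bar>?x (N + 1)\<bar>"
    show "\<bar>?x n\<bar> \<le> \<bar>?x (n + 1)\<bar>" if "N < n"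
      using growth [OF hyp, of n] that by simp
    show "2 < \<bar>?x n\<bar>" if "N \<le> n"
      using growth [OF hyp that] by simp
    \<comment> \<open>the same inequality once more, now as membership in the super band gap\<close>
    then show "2 < \<bar>?x n\<bar>" if "N \<le> n"
      using that .
  qed (use recursion in blast)+
qed

end
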